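(* Let $X, A, B \in \mathbb{R}_{\mathcal{F}}^{\wedge}$ with $[X]_1=\{\overline{x}\}$, $[A]_1=\{\overline{a}\}$ and $[B]_1=\{\overline{b}\}$. Let $P:\mathbb{R}^3\to\mathbb{R}$ be the linearization (first-order Taylor polynomial) of $g(x,y,z)=xy+z$ around $(\overline{x},\overline{a},\overline{b})$, that is, $P(x,y,z)=\overline{a}\,x+\overline{x}\,y-\overline{x}\,\overline{a}+z$. Then the function $G(X)=A\odot X+B$ is the Zadeh extension of $P$ evaluated at $(X,A,B)$, that is, $$G(X)=A\odot X+B=\hat{P}(X,A,B).$$
   Context: A fuzzy set on $\mathbb{R}$ is a function $A:\mathbb{R}\to[0,1]$. Its $\alpha$-levels are $[A]_\alpha=\{x\in\mathbb{R}: A(x)\ge\alpha\}$ for $\alpha\in(0,1]$, and $[A]_0$ is the closure of $\{x\in\mathbb{R}: A(x)>0\}$. A fuzzy number is a fuzzy set on $\mathbb{R}$ that is normal ($[A]_1\neq\emptyset$), fuzzy convex (all $\alpha$-levels are convex), upper semicontinuous, and has bounded support; equivalently, all its $\alpha$-levels, $\alpha\in[0,1]$, are non-empty compact intervals. $\mathbb{R}_{\mathcal{F}}$ denotes the set of fuzzy numbers, and $\mathbb{R}_{\mathcal{F}}^{\wedge}=\{A\in\mathbb{R}_{\mathcal{F}}: [A]_1 \text{ has exactly one element}\}$. A real number $r$ is identified with the fuzzy number given by the indicator function of $\{r\}$. The usual sum and scalar multiplication on $\mathbb{R}_{\mathcal{F}}$ are levelwise: $[A+B]_\alpha=[A]_\alpha+[B]_\alpha$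 (Minkowski sum of intervals) and $[qA]_\alpha=q[A]_\alpha=\{qx: x\in[A]_\alpha\}$ for $q\in\mathbb{R}$, for all $\alpha\in[0,1]$. Subtracting a real number $r$ means adding the real number $-r$. Cross product: for $B,C\in\mathbb{R}_{\mathcal{F}}^{\wedge}$ with $[B]_1=\{b\}$ and $[C]_1=\{c\}$, $B\odot C=cB+bC-cb$, where the operations are the usual ones on $\mathbb{R}_{\mathcal{F}}$. Zadeh extension: for $f:\mathbb{R}^3\to\mathbb{R}$ and fuzzy numbers $A_1,A_2,A_3$, $\hat f(A_1,A_2,A_3)$ is the fuzzy set on $\mathbb{R}$ given by $\hat f(A_1,A_2,A_3)(y)=\sup_{(x_1,x_2,x_3)\in f^{-1}(y)}\min\{A_1(x_1),A_2(x_2),A_3(x_3)\}$ if $f^{-1}(y)\neq\emptyset$, and $0$ otherwise, where $f^{-1}(y)=\{(x_1,x_2,x_3)\in\mathbb{R}^3: f(x_1,x_2,x_3)=y\}$. *)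

theory Defs
  imports "HOL-Analysis.Analysis" "HOL-Library.Set_Algebras"
begin

definition fuzzy_set :: "(real \<Rightarrow> real) \<Rightarrow> bool" where
  "fuzzy_set A \<longleftrightarrow> (\<forall>x. 0 \<le> A x \<and> A x \<le> 1)"

text \<open>The level sets are only meaningful for \<open>0 \<le> \<alpha> \<le> 1\<close>.\<close>

definition level :: "(real \<Rightarrow> real) \<Rightarrow> real \<Rightarrow> real set" where
  "level A \<alpha> = (if \<alpha> = 0 then closure {x. A x > 0} else {x. A x \<ge> \<alpha>})"

definition upper_semicont :: "(real \<Rightarrow> real) \<Rightarrow> bool" where
  "upper_semicont A \<longleftrightarrow> (\<forall>x c. A x < c \<longrightarrow> (\<forall>\<^sub>F y in nhds x. A y < c))"

definition fuzzy_numbers :: "(real \<Rightarrow> real) set" ("\<real>\<^sub>F") where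
  "\<real>\<^sub>F = {A. fuzzy_set A \<and> level A 1 \<noteq> {} \<and> (\<forall>\<alpha>\<in>{0..1}. convex (level A \<alpha>)) \<and>
            upper_semicont A \<and> bounded {x. A x > 0}}"

definition fuzzy_numbers_hat :: "(real \<Rightarrow> real) set" ("\<real>\<^sub>F\<^sup>\<and>") where
  "\<real>\<^sub>F\<^sup>\<and> = {A \<in> \<real>\<^sub>F. \<exists>!x. x \<in> level A 1}"

definition crisp :: "real \<Rightarrow> real \<Rightarrow> real" where
  "crisp r = indicator {r}"

lemma fuzzy_set_eqI:
  assumes A: "fuzzy_set A" and B: "fuzzy_set B"
    and lev: "\<And>\<alpha>. \<alpha> \<in> {0..1} \<Longrightarrow> level A \<alpha> = level B \<alpha>"
  shows "A = B"
proof
  fix x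
  have le: "C x \<le> D x" if "fuzzy_set C" "fuzzy_set D"
    "\<And>\<alpha>. \<alpha> \<in> {0..1} \<Longrightarrow> level C \<alpha> = level D \<alpha>" for C D
  proof (cases "C x = 0")
    case False
    then have "x \<in> level C (C x)" "C x \<in> {0..1}"
      using that(1) by (auto simp: level_def fuzzy_set_def)
    with that(3) have "x \<in> level D (C x)" by blast
    with False show ?thesis by (simp add: level_def)
  qed (use that(2) in \<open>auto simp: fuzzy_set_def\<close>)
  show "A x = B x"
    using le[OF A B lev] le[OF B A lev[symmetric]] by (meson antisym)
qed

text \<open>The levelwise operations: the result is the fuzzy number with the prescribed levels,
  which is unique by the previous lemma.  The sum of level sets is the Minkowski sum.\<close>

definition fuzzy_add :: "(real \<Rightarrow> real) \<Rightarrow> (real \<Rightarrow> real) \<Rightarrow> real \<Rightarrow> real"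
    (infixl "\<oplus>\<^sub>F" 65) where
  "A \<oplus>\<^sub>F B = (THE C. C \<in> \<real>\<^sub>F \<and> (\<forall>\<alpha>\<in>{0..1}. level C \<alpha> = level A \<alpha> + level B \<alpha>))"

definition fuzzy_scale :: "real \<Rightarrow> (real \<Rightarrow> real) \<Rightarrow> real \<Rightarrow> real"
    (infixr "\<cdot>\<^sub>F" 75) where
  "q \<cdot>\<^sub>F A = (THE C. C \<in> \<real>\<^sub>F \<and> (\<forall>\<alpha>\<in>{0..1}. level C \<alpha> = (\<lambda>x. q * x) ` level A \<alpha>))"

definition core :: "(real \<Rightarrow> real) \<Rightarrow> real" where
  "core A = (THE x. level A 1 = {x})"

text \<open>Subtracting the real number \<open>c b\<close> means adding the crisp fuzzy number \<open>- c b\<close>.\<close>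

definition cross_product :: "(real \<Rightarrow> real) \<Rightarrow> (real \<Rightarrow> real) \<Rightarrow> real \<Rightarrow> real"
    (infixl "\<odot>\<^sub>F" 70) where
  "B \<odot>\<^sub>F C = core C \<cdot>\<^sub>F B \<oplus>\<^sub>F core B \<cdot>\<^sub>F C \<oplus>\<^sub>F crisp (- (core C * core B))"

text \<open>For fuzzy sets the supremum is over values in \<open>[0, 1]\<close>, hence a genuine one.\<close>

definition zadeh_ext ::
    "(real \<times> real \<times> real \<Rightarrow> real) \<Rightarrow> (real \<Rightarrow> real) \<Rightarrow> (real \<Rightarrow> real) \<Rightarrow> (real \<Rightarrow> real) \<Rightarrow> real \<Rightarrow> real"
  where
  "zadeh_ext f A\<^sub>1 A\<^sub>2 A\<^sub>3 y =
     (if f -` {y} \<noteq> {}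
      then SUP (x\<^sub>1, x\<^sub>2, x\<^sub>3) \<in> f -` {y}. min (A\<^sub>1 x\<^sub>1) (min (A\<^sub>2 x\<^sub>2) (A\<^sub>3 x\<^sub>3))
      else 0)"

definition linearization ::
    "('a::real_normed_vector \<Rightarrow> real) \<Rightarrow> 'a \<Rightarrow> 'a \<Rightarrow> real" where
  "linearization g p v = g p + frechet_derivative g (at p) (v - p)"

end

theory Submission
  imports Defs
begin

text \<open>
  Everything rests on Nguyen's theorem: for continuous \<open>f\<close> the Zadeh extension of \<open>f\<close> at three
  fuzzy numbers is again a fuzzy number, and its \<open>\<alpha>\<close>-level is the image under \<open>f\<close> of the product
  of the three \<open>\<alpha>\<close>-levels (\<open>zadeh_ext_fuzzy_number\<close>, \<open>level_zadeh_ext\<close>).  For \<open>\<alpha> > 0\<close> the point is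
  that the supremum defining the extension is attained: the parts of a fibre of \<open>f\<close> that lie in the
  level boxes at heights \<open>\<beta> < \<alpha>\<close> are nested non-empty compact sets, so they have a common point.
  For \<open>\<alpha> = 0\<close> it is that a continuous map commutes with the closure of a bounded set.

  This one theorem also shows that the levelwise operations are well defined: the sum is the
  Zadeh extension of \<open>x + y\<close> and the scalar multiple that of \<open>q x\<close>, so fuzzy numbers with the
  prescribed levels exist.  Hence both sides of the claimed identity are fuzzy numbers whose
  \<open>\<alpha>\<close>-levels can be computed.  Each is the set of all \<open>abar x + xbar y - xbar abar + z\<close> with
  \<open>x\<close>, \<open>y\<close>, \<open>z\<close> ranging independently over the levels of \<open>X\<close>, \<open>A\<close>, \<open>B\<close>: in \<open>P\<close> every variable
  occurs exactly once, so the Minkowski sums introduce no spurious points.  A fuzzy set is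
  determined by its levels.
\<close>

section \<open>Level sets of fuzzy numbers\<close>

lemma fuzzy_number_fuzzy_set: "A \<in> \<real>\<^sub>F \<Longrightarrow> fuzzy_set A"
  by (simp add: fuzzy_numbers_def)

lemma fuzzy_set_bounds:
  assumes "fuzzy_set A"
  shows "0 \<le> A x" "A x \<le> 1"
  using assms by (auto simp: fuzzy_set_def)

lemma mem_level_pos: "0 < \<alpha> \<Longrightarrow> x \<in> level A \<alpha> \<longleftrightarrow> \<alpha> \<le> A x"
  by (simp add: level_def)

lemma upper_semicont_iff_closed: "upper_semicont A \<longleftrightarrow> (\<forall>c. closed {x. c \<le> A x})"
proof -
  have "- {x. c \<le> A x} = {x. A x < c}" for c by auto
  then have "closed {x. c \<le> A x} \<longleftrightarrow> (\<forall>x. A x < c \<longrightarrow> (\<forall>\<^sub>F y in nhds x. A y < c))" for c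
    unfolding closed_def by (subst open_subopen) (simp add: eventually_nhds subset_iff Ball_def)
  then show ?thesis by (auto simp: upper_semicont_def)
qed

lemma compact_level:
  assumes A: "A \<in> \<real>\<^sub>F" and \<alpha>: "\<alpha> \<in> {0..1}"
  shows "compact (level A \<alpha>)"
proof -
  have bdd: "bounded {x. 0 < A x}" using A by (simp add: fuzzy_numbers_def)
  show ?thesis
  proof (cases "\<alpha> = 0")
    case True
    with bdd show ?thesis by (simp add: level_def bounded_closure compact_eq_bounded_closed)
  next
    case False
    with \<alpha> have "level A \<alpha> \<subseteq> {x. 0 < A x}" by (auto simp: level_def)
    moreover have "closed (level A \<alpha>)"
      using A False by (simp add: fuzzy_numbers_def upper_semicont_iff_closed level_def)
    ultimately show ?thesis
      using bdd bounded_subset by (auto simp: compact_eq_bounded_closed)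
  qed
qed

lemma level_nonempty:
  assumes "A \<in> \<real>\<^sub>F" "\<alpha> \<in> {0..1}"
  shows "level A \<alpha> \<noteq> {}"
proof -
  obtain x where "1 \<le> A x" using assms by (auto simp: fuzzy_numbers_def level_def)
  then have "x \<in> level A \<alpha>"
    using assms closure_subset[of "{x. 0 < A x}"] by (auto simp: level_def)
  then show ?thesis by blast
qed

lemma convex_level: "A \<in> \<real>\<^sub>F \<Longrightarrow> \<alpha> \<in> {0..1} \<Longrightarrow> convex (level A \<alpha>)"
  by (simp add: fuzzy_numbers_def)

lemma core_eqI: "level A 1 = {a} \<Longrightarrow> core A = a"
  by (simp add: core_def)

section \<open>Levels of the Zadeh extension\<close>

definition joint_membership ::
    "(real \<Rightarrow> real) \<Rightarrow> (real \<Rightarrow> real) \<Rightarrow> (real \<Rightarrow> real) \<Rightarrow> real \<times> real \<times> real \<Rightarrow> real" where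
  "joint_membership A B C = (\<lambda>(x, y, z). min (A x) (min (B y) (C z)))"

definition level_box ::
    "(real \<Rightarrow> real) \<Rightarrow> (real \<Rightarrow> real) \<Rightarrow> (real \<Rightarrow> real) \<Rightarrow> real \<Rightarrow> (real \<times> real \<times> real) set" where
  "level_box A B C \<alpha> = level A \<alpha> \<times> level B \<alpha> \<times> level C \<alpha>"

lemma zadeh_ext_joint_membership:
  "zadeh_ext f A B C y =
     (if f -` {y} \<noteq> {} then SUP p \<in> f -` {y}. joint_membership A B C p else 0)"
  by (simp add: zadeh_ext_def joint_membership_def)

lemma mem_level_box_pos:
  "0 < \<alpha> \<Longrightarrow> p \<in> level_box A B C \<alpha> \<longleftrightarrow> \<alpha> \<le> joint_membership A B C p"
  by (cases p) (auto simp: level_box_def joint_membership_def level_def)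

lemma level_box_0: "level_box A B C 0 = closure {p. 0 < joint_membership A B C p}"
proof -
  have "{p. 0 < joint_membership A B C p} = {x. 0 < A x} \<times> {x. 0 < B x} \<times> {x. 0 < C x}"
    by (auto simp: joint_membership_def)
  then show ?thesis by (simp add: level_box_def level_def closure_Times)
qed

context
  fixes A B C :: "real \<Rightarrow> real"
  assumes A: "A \<in> \<real>\<^sub>F" and B: "B \<in> \<real>\<^sub>F" and C: "C \<in> \<real>\<^sub>F"
begin

lemma joint_membership_bounds:
  "0 \<le> joint_membership A B C p" "joint_membership A B C p \<le> 1"
  using fuzzy_set_bounds[OF fuzzy_number_fuzzy_set[OF A]]
    fuzzy_set_bounds[OF fuzzy_number_fuzzy_set[OF B]]
    fuzzy_set_bounds[OF fuzzy_number_fuzzy_set[OF C]]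
  by (auto simp: joint_membership_def min_le_iff_disj split: prod.split)

lemma bdd_above_joint_membership: "bdd_above (joint_membership A B C ` S)"
  using joint_membership_bounds(2) by (auto intro!: bdd_aboveI)

lemma compact_level_box: "\<alpha> \<in> {0..1} \<Longrightarrow> compact (level_box A B C \<alpha>)"
  unfolding level_box_def by (intro compact_Times compact_level A B C)

lemma joint_membership_le_zadeh_ext: "joint_membership A B C p \<le> zadeh_ext f A B C (f p)"
proof -
  have "p \<in> f -` {f p}" by simp
  then show ?thesis
    using cSUP_upper[OF _ bdd_above_joint_membership] by (auto simp: zadeh_ext_joint_membership)
qed

lemma fuzzy_set_zadeh_ext: "fuzzy_set (zadeh_ext f A B C)"
  unfolding fuzzy_set_def
proof
  fix y
  show "0 \<le> zadeh_ext f A B C y \<and> zadeh_ext f A B C y \<le> 1"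
  proof (cases "f -` {y} = {}")
    case False
    then obtain p where "f p = y" by blast
    then have "0 \<le> zadeh_ext f A B C y"
      using joint_membership_le_zadeh_ext[of p f] joint_membership_bounds(1)[of p] by simp
    moreover have "zadeh_ext f A B C y \<le> 1"
      using False joint_membership_bounds(2)
      by (auto simp: zadeh_ext_joint_membership intro!: cSUP_least)
    ultimately show ?thesis ..
  qed (simp add: zadeh_ext_joint_membership)
qed

lemma less_zadeh_extD:
  assumes "0 \<le> c" "c < zadeh_ext f A B C y"
  obtains p where "f p = y" "c < joint_membership A B C p"
proof -
  have ne: "f -` {y} \<noteq> {}" using assms by (auto simp: zadeh_ext_joint_membership)
  with assms(2) have "c < (SUP p \<in> f -` {y}. joint_membership A B C p)"
    by (simp add: zadeh_ext_joint_membership)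
  then show thesis
    using that less_cSUP_iff[OF ne bdd_above_joint_membership] by auto
qed

text \<open>The supremum is attained: the heights \<open>h n = \<alpha> (1 - 1 / (n + 2))\<close> increase to \<open>\<alpha>\<close> and stay
  positive, and the corresponding pieces of the fibre over \<open>y\<close> are nested, compact and non-empty.
  A common point has joint membership at least \<open>\<alpha>\<close>.\<close>

lemma zadeh_ext_attained:
  assumes f: "continuous_on UNIV f" and \<alpha>: "0 < \<alpha>" "\<alpha> \<le> zadeh_ext f A B C y"
  obtains p where "f p = y" "\<alpha> \<le> joint_membership A B C p"
proof -
  define h where "h n = \<alpha> * (1 - inverse (real (Suc (Suc n))))" for n
  have h_pos: "0 < h n" and h_less: "h n < \<alpha>" for n
    using \<alpha>(1) by (simp_all add: h_def inverse_less_1_iff)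
  have h_mono: "h m \<le> h n" if "m \<le> n" for m n
    using \<alpha> that by (auto simp: h_def intro!: mult_left_mono le_imp_inverse_le)
  have "h \<longlonglongrightarrow> \<alpha> * (1 - 0)"
    unfolding h_def
    by (intro tendsto_intros LIMSEQ_Suc[OF LIMSEQ_inverse_real_of_nat])
  then have h_lim: "h \<longlonglongrightarrow> \<alpha>" by simp
  have "\<alpha> \<le> 1" using \<alpha>(2) fuzzy_set_bounds(2)[OF fuzzy_set_zadeh_ext] order_trans by blast
  then have h_le1: "h n \<le> 1" for n using h_less[of n] by simp
  define K where "K n = level_box A B C (h n) \<inter> f -` {y}" for n
  have "compact (K n)" for n
    unfolding K_def using h_pos[of n] h_le1[of n] f
    by (intro compact_Int_closed compact_level_box)
       (auto simp: continuous_on_closed_vimage)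
  moreover have "K n \<noteq> {}" for n
  proof -
    have "h n < zadeh_ext f A B C y" using h_less[of n] \<alpha>(2) by simp
    then obtain p where "f p = y" "h n < joint_membership A B C p"
      using less_zadeh_extD h_pos[of n] less_imp_le by metis
    then have "p \<in> K n" using h_pos[of n] by (simp add: K_def mem_level_box_pos)
    then show ?thesis by blast
  qed
  moreover have "K n \<subseteq> K m" if "m \<le> n" for m n
    using h_mono[OF that] h_pos by (auto simp: K_def mem_level_box_pos)
  ultimately have "\<Inter> (range K) \<noteq> {}" by (rule compact_nest)
  then obtain p where p: "p \<in> K n" for n by blast
  have "h n \<le> joint_membership A B C p" for n
    using p[of n] h_pos[of n] by (simp add: K_def mem_level_box_pos)
  then have "\<alpha> \<le> joint_membership A B C p" using h_lim by (meson LIMSEQ_le_const2)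
  moreover have "f p = y" using p by (auto simp: K_def)
  ultimately show thesis using that by blast
qed

text \<open>Nguyen's theorem.  At positive heights it restates that the supremum is attained.  At height
  \<open>0\<close> attainment is not enough, since \<open>f\<close> has to be interchanged with a closure, which the
  boundedness of the supports permits.\<close>

lemma level_zadeh_ext:
  assumes f: "continuous_on UNIV f" and \<alpha>: "\<alpha> \<in> {0..1}"
  shows "level (zadeh_ext f A B C) \<alpha> = f ` level_box A B C \<alpha>"
proof (cases "\<alpha> = 0")
  case True
  define S where "S = {p. 0 < joint_membership A B C p}"
  have box: "level_box A B C 0 = closure S" by (simp add: S_def level_box_0)
  have "{y. 0 < zadeh_ext f A B C y} = f ` S"
    unfolding S_def using joint_membership_le_zadeh_ext
    by (auto elim!: less_zadeh_extD[OF order_refl] intro: less_le_trans)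
  then have "level (zadeh_ext f A B C) 0 = closure (f ` S)" by (simp add: level_def)
  also have "\<dots> = f ` closure S"
  proof
    \<comment> \<open>The support is bounded, so the image of its closure is compact, hence closed.\<close>
    have "compact (f ` closure S)"
      using compact_level_box[of 0] f box
      by (auto intro!: compact_continuous_image intro: continuous_on_subset)
    then show "closure (f ` S) \<subseteq> f ` closure S"
      by (intro closure_minimal image_mono closure_subset compact_imp_closed)
    show "f ` closure S \<subseteq> closure (f ` S)"
      using f
      by (intro image_closure_subset)
         (auto intro: continuous_on_subset closure_subset[THEN subsetD])
  qed
  finally show ?thesis by (simp add: True box)
next
  case False
  with \<alpha> have pos: "0 < \<alpha>" by simp
  show ?thesis
  proof safe
    fix y assume "y \<in> level (zadeh_ext f A B C) \<alpha>"
    then show "y \<in> f ` level_box A B C \<alpha>"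
      using zadeh_ext_attained[OF f pos, of y] pos
      by (metis image_eqI mem_level_pos mem_level_box_pos)
  next
    fix p assume "p \<in> level_box A B C \<alpha>"
    then show "f p \<in> level (zadeh_ext f A B C) \<alpha>"
      using joint_membership_le_zadeh_ext[of p f] pos
      by (simp add: mem_level_pos mem_level_box_pos)
  qed
qed

text \<open>Each level is a continuous image of a product of compact intervals, hence compact and
  connected, and connected sets of reals are convex.  Closed levels give upper semicontinuity.\<close>

lemma zadeh_ext_fuzzy_number:
  assumes f: "continuous_on UNIV f"
  shows "zadeh_ext f A B C \<in> \<real>\<^sub>F"
proof -
  let ?Z = "zadeh_ext f A B C"
  have f': "continuous_on S f" for S using f continuous_on_subset by blast
  have cpt: "compact (level ?Z \<alpha>)" if "\<alpha> \<in> {0..1}" for \<alpha>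
    unfolding level_zadeh_ext[OF f that] by (intro compact_continuous_image f' compact_level_box that)
  have "convex (level ?Z \<alpha>)" if "\<alpha> \<in> {0..1}" for \<alpha>
  proof -
    have "connected (level_box A B C \<alpha>)"
      unfolding level_box_def using that
      by (intro convex_connected convex_Times convex_level A B C)
    then have "connected (level ?Z \<alpha>)"
      unfolding level_zadeh_ext[OF f that] by (intro connected_continuous_image f')
    then show ?thesis by (simp flip: is_interval_convex_1 is_interval_connected_1)
  qed
  moreover have "level ?Z 1 \<noteq> {}"
    using level_zadeh_ext[OF f, of 1] level_nonempty[OF A, of 1] level_nonempty[OF B, of 1]
      level_nonempty[OF C, of 1] by (simp add: level_box_def)
  moreover have "upper_semicont ?Z"
    unfolding upper_semicont_iff_closed
  proof
    fix c :: real
    consider "c \<le> 0" | "0 < c" "c \<le> 1" | "1 < c" by linarith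
    then show "closed {y. c \<le> ?Z y}"
    proof cases
      case 1
      then have "{y. c \<le> ?Z y} = UNIV"
        using fuzzy_set_bounds(1)[OF fuzzy_set_zadeh_ext] order_trans by blast
      then show ?thesis by simp
    next
      case 2
      then show ?thesis using cpt[of c] by (simp add: level_def compact_imp_closed)
    next
      case 3
      then have "{y. c \<le> ?Z y} = {}"
        using fuzzy_set_bounds(2)[OF fuzzy_set_zadeh_ext] by (auto simp: not_le intro: le_less_trans)
      then show ?thesis by simp
    qed
  qed
  moreover have "bounded {y. 0 < ?Z y}"
    using cpt[of 0] bounded_subset[OF compact_imp_bounded closure_subset] by (simp add: level_def)
  ultimately show ?thesis by (simp add: fuzzy_numbers_def fuzzy_set_zadeh_ext)
qed

end

section \<open>Levelwise operations\<close>

lemma the_fuzzy_number_with_levels: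
  assumes "C \<in> \<real>\<^sub>F" "\<And>\<alpha>. \<alpha> \<in> {0..1} \<Longrightarrow> level C \<alpha> = L \<alpha>"
  shows "(THE C. C \<in> \<real>\<^sub>F \<and> (\<forall>\<alpha>\<in>{0..1}. level C \<alpha> = L \<alpha>)) = C"
  using assms by (intro the_equality) (auto intro!: fuzzy_set_eqI fuzzy_number_fuzzy_set)

text \<open>Sum and scalar multiple are Zadeh extensions of functions that ignore some of their three
  arguments.  The dummy arguments have non-empty levels, so they do not affect the images of the
  level boxes.\<close>

lemma
  assumes A: "A \<in> \<real>\<^sub>F" and B: "B \<in> \<real>\<^sub>F"
  shows level_fuzzy_add: "\<alpha> \<in> {0..1} \<Longrightarrow> level (A \<oplus>\<^sub>F B) \<alpha> = level A \<alpha> + level B \<alpha>"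
    and fuzzy_add_fuzzy_number: "A \<oplus>\<^sub>F B \<in> \<real>\<^sub>F"
proof -
  let ?Z = "zadeh_ext (\<lambda>(x, y, z). x + y) A B B"
  have cont: "continuous_on UNIV (\<lambda>(x, y, z). x + y :: real)"
    by (auto simp: case_prod_unfold intro!: continuous_intros)
  have Z: "?Z \<in> \<real>\<^sub>F" by (intro zadeh_ext_fuzzy_number A B cont)
  have lev: "level ?Z \<alpha> = level A \<alpha> + level B \<alpha>" if \<alpha>: "\<alpha> \<in> {0..1}" for \<alpha>
  proof -
    obtain b where "b \<in> level B \<alpha>" using level_nonempty[OF B \<alpha>] by blast
    then show ?thesis
      unfolding level_zadeh_ext[OF A B B cont \<alpha>] level_box_def
      by (fastforce simp: set_plus_def image_iff)
  qed
  have eq: "A \<oplus>\<^sub>F B = ?Z"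
    unfolding fuzzy_add_def by (rule the_fuzzy_number_with_levels[OF Z lev])
  show "\<alpha> \<in> {0..1} \<Longrightarrow> level (A \<oplus>\<^sub>F B) \<alpha> = level A \<alpha> + level B \<alpha>" "A \<oplus>\<^sub>F B \<in> \<real>\<^sub>F"
    using Z lev by (simp_all add: eq)
qed

lemma
  assumes A: "A \<in> \<real>\<^sub>F"
  shows level_fuzzy_scale: "\<alpha> \<in> {0..1} \<Longrightarrow> level (q \<cdot>\<^sub>F A) \<alpha> = (\<lambda>x. q * x) ` level A \<alpha>"
    and fuzzy_scale_fuzzy_number: "q \<cdot>\<^sub>F A \<in> \<real>\<^sub>F"
proof -
  let ?Z = "zadeh_ext (\<lambda>(x, y, z). q * x) A A A"
  have cont: "continuous_on UNIV (\<lambda>(x, y, z). q * x)"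
    by (auto simp: case_prod_unfold intro!: continuous_intros)
  have Z: "?Z \<in> \<real>\<^sub>F" by (intro zadeh_ext_fuzzy_number A cont)
  have lev: "level ?Z \<alpha> = (\<lambda>x. q * x) ` level A \<alpha>" if "\<alpha> \<in> {0..1}" for \<alpha>
    using level_nonempty[OF A that]
    by (auto simp: level_zadeh_ext[OF A A A cont that] level_box_def image_iff)
  have eq: "q \<cdot>\<^sub>F A = ?Z"
    unfolding fuzzy_scale_def by (rule the_fuzzy_number_with_levels[OF Z lev])
  show "\<alpha> \<in> {0..1} \<Longrightarrow> level (q \<cdot>\<^sub>F A) \<alpha> = (\<lambda>x. q * x) ` level A \<alpha>" "q \<cdot>\<^sub>F A \<in> \<real>\<^sub>F"
    using Z lev by (simp_all add: eq)
qed

lemma level_crisp: "\<alpha> \<in> {0..1} \<Longrightarrow> level (crisp r) \<alpha> = {r}"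
  by (auto simp: level_def crisp_def indicator_def of_bool_def split: if_splits)

lemma crisp_fuzzy_number: "crisp r \<in> \<real>\<^sub>F"
proof -
  have "closed {x. c \<le> crisp r x}" for c
  proof -
    have "{x. c \<le> crisp r x} = (if c \<le> 0 then UNIV else if c \<le> 1 then {r} else {})"
      by (auto simp: crisp_def indicator_def)
    then show ?thesis by simp
  qed
  moreover have "{x. 0 < crisp r x} = {r}" by (auto simp: crisp_def indicator_def)
  ultimately show ?thesis
    by (auto simp: fuzzy_numbers_def upper_semicont_iff_closed level_crisp fuzzy_set_def)
       (auto simp: crisp_def indicator_def)
qed

lemma cross_product_fuzzy_number:
  "B \<in> \<real>\<^sub>F \<Longrightarrow> C \<in> \<real>\<^sub>F \<Longrightarrow> B \<odot>\<^sub>F C \<in> \<real>\<^sub>F"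
  unfolding cross_product_def
  by (intro fuzzy_add_fuzzy_number fuzzy_scale_fuzzy_number crisp_fuzzy_number)

lemma level_cross_product:
  assumes "B \<in> \<real>\<^sub>F" "C \<in> \<real>\<^sub>F" "\<alpha> \<in> {0..1}"
  shows "level (B \<odot>\<^sub>F C) \<alpha> =
    (\<lambda>x. core C * x) ` level B \<alpha> + (\<lambda>x. core B * x) ` level C \<alpha> + {- (core C * core B)}"
  using assms unfolding cross_product_def
  by (simp add: level_fuzzy_add level_fuzzy_scale level_crisp
      fuzzy_add_fuzzy_number fuzzy_scale_fuzzy_number crisp_fuzzy_number)

section \<open>The linearization as a Zadeh extension\<close>

lemma linearization_xy_plus_z:
  "linearization (\<lambda>(x, y, z). x * y + z) (a, b, c) =
    (\<lambda>(x, y, z). b * x + a * y - a * b + z :: real)"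
proof -
  have "((\<lambda>(x, y, z). x * y + z) has_derivative (\<lambda>(h, k, l). a * k + h * b + l)) (at (a, b, c))"
    unfolding case_prod_unfold by (auto intro!: derivative_eq_intros)
  from frechet_derivative_at[OF this, symmetric] show ?thesis
    by (auto simp: linearization_def fun_eq_iff algebra_simps)
qed

theorem proposition1:
  fixes X A B :: "real \<Rightarrow> real" and xbar abar bbar :: real
    and g P :: "real \<times> real \<times> real \<Rightarrow> real"
  assumes "X \<in> \<real>\<^sub>F\<^sup>\<and>" and "A \<in> \<real>\<^sub>F\<^sup>\<and>" and "B \<in> \<real>\<^sub>F\<^sup>\<and>"
    and "level X 1 = {xbar}" and "level A 1 = {abar}" and "level B 1 = {bbar}"
    and "g = (\<lambda>(x, y, z). x * y + z)"
    and "P = linearization g (xbar, abar, bbar)"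
  shows "P = (\<lambda>(x, y, z). abar * x + xbar * y - xbar * abar + z) \<and>
         A \<odot>\<^sub>F X \<oplus>\<^sub>F B = zadeh_ext P X A B"
proof
  show P: "P = (\<lambda>(x, y, z). abar * x + xbar * y - xbar * abar + z)"
    using assms(7,8) by (simp add: linearization_xy_plus_z)
  have X: "X \<in> \<real>\<^sub>F" and A: "A \<in> \<real>\<^sub>F" and B: "B \<in> \<real>\<^sub>F"
    using assms(1-3) by (auto simp: fuzzy_numbers_hat_def)
  have AX: "A \<odot>\<^sub>F X \<in> \<real>\<^sub>F" by (intro cross_product_fuzzy_number A X)
  have cont: "continuous_on UNIV P"
    unfolding P case_prod_unfold by (intro continuous_intros)
  show "A \<odot>\<^sub>F X \<oplus>\<^sub>F B = zadeh_ext P X A B"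
  proof (rule fuzzy_set_eqI)
    show "fuzzy_set (A \<odot>\<^sub>F X \<oplus>\<^sub>F B)"
      by (intro fuzzy_number_fuzzy_set fuzzy_add_fuzzy_number AX B)
    show "fuzzy_set (zadeh_ext P X A B)"
      by (intro fuzzy_set_zadeh_ext X A B)
    fix \<alpha> :: real assume \<alpha>: "\<alpha> \<in> {0..1}"
    have "level (A \<odot>\<^sub>F X \<oplus>\<^sub>F B) \<alpha> =
        (\<lambda>y. xbar * y) ` level A \<alpha> + (\<lambda>x. abar * x) ` level X \<alpha> + {- (xbar * abar)} + level B \<alpha>"
      using assms(4,5) A X \<alpha>
      by (simp add: level_fuzzy_add[OF AX B] level_cross_product core_eqI)
    also have "\<dots> = P ` level_box X A B \<alpha>"
    proof (intro set_eqI iffI)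
      fix w
      assume "w \<in> (\<lambda>y. xbar * y) ` level A \<alpha> + (\<lambda>x. abar * x) ` level X \<alpha> + {- (xbar * abar)} + level B \<alpha>"
      then obtain x y z where "x \<in> level X \<alpha>" "y \<in> level A \<alpha>" "z \<in> level B \<alpha>"
        "w = xbar * y + abar * x + - (xbar * abar) + z"
        by (auto elim!: set_plus_elim)
      then show "w \<in> P ` level_box X A B \<alpha>"
        by (auto simp: P level_box_def intro!: image_eqI[of _ _ "(x, y, z)"])
    next
      fix w
      assume "w \<in> P ` level_box X A B \<alpha>"
      then obtain x y z where xyz: "x \<in> level X \<alpha>" "y \<in> level A \<alpha>" "z \<in> level B \<alpha>"
        and "w = xbar * y + abar * x + - (xbar * abar) + z"
        by (auto simp: P level_box_def)
      then show "w \<in> (\<lambda>y. xbar * y) ` level A \<alpha> + (\<lambda>x. abar * x) ` level X \<alpha> + {- (xbar * abar)} + level B \<alpha>"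
        by (auto simp del: add_uminus_conv_diff intro!: set_plus_intro)
    qed
    also have "\<dots> = level (zadeh_ext P X A B) \<alpha>"
      by (rule level_zadeh_ext[OF X A B cont \<alpha>, symmetric])
    finally show "level (A \<odot>\<^sub>F X \<oplus>\<^sub>F B) \<alpha> = level (zadeh_ext P X A B) \<alpha>" .
  qed
qed

end
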